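(* Let $T>0$ and let $p_H^r(t)\in\mathbb{R}^3$ and $f_c^r(t)\in\mathbb{R}^3\setminus\{0\}$, $t\in[0,T]$, be a time-varying human position reference and a time-varying desired cable force, with $z_W^\top p_H^r(T)=0$ and $f_c^r(T)=f_z z_W$, $0<f_z<m_Hg$. Set $p_R^r(t)=p_H^r(t)+f_c^r(t)\left(\frac1{k_c}+\frac{\bar l_c}{\|f_c^r(t)\|}\right)$. Consider the system with state $x=[p_H^\top\ v_H^\top\ p_R^\top\ v_R^\top]^\top\in\mathcal{X}$ and dynamics $$\dot p_H=v_H,\quad \dot v_H=\tfrac1{m_H}\left(-m_Hg\,z_W-B_Hv_H+f_c+f_g\right),\quad \dot p_R=v_R,\quad \dot v_R=M_A^{-1}\left(-B_Av_R-f_c+u_A\right),$$ under the control law $$u_A(t)=K_H\,(p_R^r(T)-p_R(t))+f_c^r(T)+u_A'(t),\qquad u_A'(t)=K_H\,(p_R^r(t)-p_R^r(T))+f_c^r(t)-f_c^r(T)$$ (so that $u_A(t)=K_H(p_R^r(t)-p_R(t))+f_c^r(t)$). Then this system is output-strictly passive with respect to the input-output pair $(u_1,y_1)=(u_A',v_R)$, with storage function $$V(x)=\tfrac12\left(m_Hv_H^\top v_H+v_R^\top M_Av_R+e^\top K_He\right)+\int_{l_{c0}}^{\|l_c\|}t_c(\tau)\,d\tau-l_c^\top f_c^r(T)+V_0,\qquad e=p_R^r(T)-p_R,\ \ l_c=p_R-p_H,$$ where $l_{c0}=\|l_c(0)\|$ and $V_0$ is the constant such that $V(\bar x)=0$ for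 $\bar x=[p_H^r(T)^\top\ 0^\top\ p_R^r(T)^\top\ 0^\top]^\top$.
   Context: Constants: $m_H,g,k_c,\bar l_c,k_H>0$; $B_H\in\mathbb{R}^{3\times3}$ positive definite; $M_A,B_A\in\mathbb{R}^{3\times 3}$ positive definite diagonal; $K_H=\mathrm{diag}(k_H,k_H,0)$. $\{x_W,y_W,z_W\}$ is the canonical orthonormal basis of $\mathbb{R}^3$, with $z_W$ pointing vertically upward. $p_H,v_H\in\mathbb{R}^3$ are the position and velocity of the human (hand), and $p_R,v_R\in\mathbb{R}^3$ those of the aerial robot. Cable force: let $l_c=p_R-p_H$ and define the tension $t_c(\ell)=k_c(\ell-\bar l_c)$ if $\ell>\bar l_c$ and $t_c(\ell)=0$ otherwise. The cable force on the human is $f_c=t_c(\|l_c\|)\,l_c/\|l_c\|$ (equal to $0$ when $\|l_c\|\le\bar l_c$, including $l_c=0$). The force on the robot is $-f_c$. Ground constraint: the ground is flat and horizontal and the human is constrained to it, i.e. the state space is $\mathcal{X}=\{x\in\mathbb{R}^{12}: z_W^\top p_H=0,\ z_W^\top v_H=0\}$. The ground reaction $f_g$ is vertical, $f_g=\lambda z_W$, where the scalar $\lambda$ is the value for which $z_W^\top\dot v_H=0$. It is a standing assumption that the human stays on the ground (the reaction intensity satisfies $\lambda\ge 0$; the cable never lifts the human). Output-strict passivity (Khalil): a system with input $u$ and output $y$ of the same dimension is output-strictly passive with storage function $V$ if $V$ is continuously differentiable and positive semidefinite ($V\ge0$ on $\mathcal{X}$), and there is a function $\phi$ with $y^\top\phi(y)>0$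 for all $y\neq0$ such that, along the system dynamics, $\dot V\le u^\top y-y^\top\phi(y)$ for every state and every input value. *)

theory Defs
  imports "HOL-Analysis.Analysis"
begin

definition positive_definite :: "real^'n^'n \<Rightarrow> bool" where
  "positive_definite A \<longleftrightarrow> (\<forall>x. x \<noteq> 0 \<longrightarrow> 0 < x \<bullet> (A *v x))"

definition diagonal :: "real^'n^'n \<Rightarrow> bool" where
  "diagonal A \<longleftrightarrow> (\<forall>i j. i \<noteq> j \<longrightarrow> A $ i $ j = 0)"

(* The state space X is a subset of a Euclidean space and may have empty interior. V is
   required to be C^1 on the ambient space, so that its gradient is unique and the derivative
   of V along the dynamics at a point of X, with constant input value u, is gradV x \<bullet> f x u. *)
definition output_strictly_passive ::
  "'s::euclidean_space set \<Rightarrow> ('s \<Rightarrow> 'u::euclidean_space \<Rightarrow> 's) \<Rightarrow> ('s \<Rightarrow> 'u) \<Rightarrow> ('s \<Rightarrow> real) \<Rightarrow> bool"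
where
  "output_strictly_passive X f h V \<longleftrightarrow>
     (\<exists>gradV. (\<forall>x. GDERIV V x :> gradV x) \<and> continuous_on UNIV gradV \<and>
        (\<forall>x\<in>X. 0 \<le> V x) \<and>
        (\<exists>\<phi>. (\<forall>y. y \<noteq> 0 \<longrightarrow> 0 < y \<bullet> \<phi> y) \<and>
             (\<forall>x\<in>X. \<forall>u. gradV x \<bullet> f x u \<le> u \<bullet> h x - h x \<bullet> \<phi> (h x))))"

record hr_params =
  mass_H :: real          (* m_H *)
  grav :: real            (* g *)
  stiff_c :: real         (* k_c *)
  rest_len :: real        (* rest length of the cable *)
  gain_H :: real          (* k_H *)
  damp_H :: "real^3^3"    (* B_H *)
  inertia_A :: "real^3^3" (* M_A *)
  damp_A :: "real^3^3"    (* B_A *)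

definition zW :: "real^3" where
  "zW = axis 3 1"

definition KH :: "hr_params \<Rightarrow> real^3^3" where
  "KH P = vector [vector [gain_H P, 0, 0], vector [0, gain_H P, 0], vector [0, 0, 0]]"

(* (p_H, v_H, p_R, v_R) *)
type_synonym state = "(real^3) \<times> (real^3) \<times> (real^3) \<times> (real^3)"

definition pos_H :: "state \<Rightarrow> real^3" where "pos_H x = fst x"
definition vel_H :: "state \<Rightarrow> real^3" where "vel_H x = fst (snd x)"
definition pos_R :: "state \<Rightarrow> real^3" where "pos_R x = fst (snd (snd x))"
definition vel_R :: "state \<Rightarrow> real^3" where "vel_R x = snd (snd (snd x))"

definition state_space :: "state set" where
  "state_space = {x. zW \<bullet> pos_H x = 0 \<and> zW \<bullet> vel_H x = 0}"

definition cable :: "state \<Rightarrow> real^3" where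
  "cable x = pos_R x - pos_H x"

definition tension :: "hr_params \<Rightarrow> real \<Rightarrow> real" where
  "tension P l = (if l > rest_len P then stiff_c P * (l - rest_len P) else 0)"

definition cable_force :: "hr_params \<Rightarrow> state \<Rightarrow> real^3" where
  "cable_force P x = tension P (norm (cable x)) *\<^sub>R (cable x /\<^sub>R norm (cable x))"

definition accel_H :: "hr_params \<Rightarrow> state \<Rightarrow> real^3 \<Rightarrow> real^3" where
  "accel_H P x fg = (1 / mass_H P) *\<^sub>R
     (- (mass_H P * grav P) *\<^sub>R zW - damp_H P *v vel_H x + cable_force P x + fg)"

(* The intensity is taken at every state, whatever its sign; the states in which the cable
   does not lift the human are those where it is nonnegative. *)
definition ground_intensity :: "hr_params \<Rightarrow> state \<Rightarrow> real" where
  "ground_intensity P x = (THE r. zW \<bullet> accel_H P x (r *\<^sub>R zW) = 0)"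

definition ground_force :: "hr_params \<Rightarrow> state \<Rightarrow> real^3" where
  "ground_force P x = ground_intensity P x *\<^sub>R zW"

definition accel_R :: "hr_params \<Rightarrow> state \<Rightarrow> real^3 \<Rightarrow> real^3" where
  "accel_R P x uA = matrix_inv (inertia_A P) *v (- (damp_A P *v vel_R x) - cable_force P x + uA)"

definition dynamics :: "hr_params \<Rightarrow> state \<Rightarrow> real^3 \<Rightarrow> state" where
  "dynamics P x uA = (vel_H x, accel_H P x (ground_force P x), vel_R x, accel_R P x uA)"

text \<open>Below, \<open>pHr\<close> and \<open>fcr\<close> are the references for the human position and the cable force.\<close>

definition robot_ref ::
  "hr_params \<Rightarrow> (real \<Rightarrow> real^3) \<Rightarrow> (real \<Rightarrow> real^3) \<Rightarrow> real \<Rightarrow> real^3" where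
  "robot_ref P pHr fcr t =
     pHr t + (1 / stiff_c P + rest_len P / norm (fcr t)) *\<^sub>R fcr t"

definition control_law ::
  "hr_params \<Rightarrow> (real \<Rightarrow> real^3) \<Rightarrow> (real \<Rightarrow> real^3) \<Rightarrow> real \<Rightarrow> state \<Rightarrow> real^3 \<Rightarrow> real^3" where
  "control_law P pHr fcr T x u' = KH P *v (robot_ref P pHr fcr T - pos_R x) + fcr T + u'"

definition ref_input ::
  "hr_params \<Rightarrow> (real \<Rightarrow> real^3) \<Rightarrow> (real \<Rightarrow> real^3) \<Rightarrow> real \<Rightarrow> real \<Rightarrow> real^3" where
  "ref_input P pHr fcr T t =
     KH P *v (robot_ref P pHr fcr t - robot_ref P pHr fcr T) + fcr t - fcr T"

(* The interval integral is oriented: it is negative when the cable is shorter than lc0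
   and the tension does not vanish in between. *)
definition storage ::
  "hr_params \<Rightarrow> (real \<Rightarrow> real^3) \<Rightarrow> (real \<Rightarrow> real^3) \<Rightarrow> real \<Rightarrow> real \<Rightarrow> real \<Rightarrow> state \<Rightarrow> real" where
  "storage P pHr fcr T lc0 V0 x =
     (let e = robot_ref P pHr fcr T - pos_R x in
      1/2 * (mass_H P * (vel_H x \<bullet> vel_H x) + vel_R x \<bullet> (inertia_A P *v vel_R x)
             + e \<bullet> (KH P *v e))
      + (LBINT \<tau>=lc0..norm (cable x). tension P \<tau>)
      - cable x \<bullet> fcr T + V0)"

definition final_state ::
  "hr_params \<Rightarrow> (real \<Rightarrow> real^3) \<Rightarrow> (real \<Rightarrow> real^3) \<Rightarrow> real \<Rightarrow> state" where
  "final_state P pHr fcr T = (pHr T, 0, robot_ref P pHr fcr T, 0)"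

end

theory Submission
  imports Defs
begin

text \<open>
  Along the dynamics the gravity, the ground reaction and \<open>f\<^sub>c\<^sup>r(T)\<close> are all vertical, so they do no
  work on the horizontally moving human; the cable forces on both ends cancel against the
  elastic energy and the proportional term against \<open>e\<^sup>T K\<^sub>H e / 2\<close>. What remains of the derivative of
  \<open>V\<close> is \<open>u \<bullet> v\<^sub>R\<close> minus the two damping terms. Nonnegativity holds because
  \<open>E(\<ell>) - l\<^sub>c \<bullet> f\<^sub>c\<^sup>r(T) \<ge> E(\<ell>) - f\<^sub>z \<ell>\<close> with \<open>\<ell> = \<parallel>l\<^sub>c\<parallel>\<close> and elastic energy \<open>E\<close>, and the right-hand
  side is minimal where the tension equals \<open>f\<^sub>z\<close>, which is the length of the cable in the final state.
\<close>

section \<open>Positive definite, diagonal and symmetric matrices\<close>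

lemma positive_definite_invertible:
  fixes A :: "real^'n^'n"
  assumes "positive_definite A"
  shows "invertible A"
proof -
  have "x = 0" if "A *v x = 0" for x
    using assms that unfolding positive_definite_def by (metis inner_zero_right less_irrefl)
  then show ?thesis
    by (meson invertible_left_inverse matrix_left_invertible_ker)
qed

lemma matrix_inv_right:
  fixes A :: "real^'n^'n"
  assumes "invertible A"
  shows "A ** matrix_inv A = mat 1"
  using someI_ex[OF assms[unfolded invertible_def]] by (simp add: matrix_inv_def)

lemma positive_definite_nonneg:
  "positive_definite A \<Longrightarrow> 0 \<le> x \<bullet> (A *v x)"
  unfolding positive_definite_def by (cases "x = 0") (auto simp: less_imp_le)

lemma diagonal_transpose: "diagonal A \<Longrightarrow> transpose A = A"
  unfolding diagonal_def transpose_def by (simp add: vec_eq_iff) metis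

lemma inner_matrix_symmetric:
  fixes A :: "real^'n^'n"
  assumes "transpose A = A"
  shows "x \<bullet> (A *v y) = y \<bullet> (A *v x)"
  by (metis assms dot_lmul_matrix inner_commute transpose_matrix_vector)

lemma diagonal_KH: "diagonal (KH P)"
  by (simp add: diagonal_def KH_def forall_3)

text \<open>The vertical gain is zero, so \<open>KH P\<close> is only semidefinite and its quadratic
  form is written out as a sum of two squares.\<close>

lemma KH_nonneg:
  assumes "0 < gain_H P"
  shows "0 \<le> e \<bullet> (KH P *v e)"
proof -
  have "e \<bullet> (KH P *v e) = gain_H P * ((e $ 1)\<^sup>2 + (e $ 2)\<^sup>2)"
    by (simp add: KH_def inner_vec_def matrix_vector_mult_def sum_3 power2_eq_square algebra_simps)
  with assms show ?thesis
    by simp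
qed

section \<open>Elastic energy and force of the cable\<close>

text \<open>The antiderivative of \<open>tension P\<close> that vanishes for a slack cable. Writing
  it with \<open>max\<close> gives one formula for both regimes.\<close>

definition elastic_energy :: "hr_params \<Rightarrow> real \<Rightarrow> real" where
  "elastic_energy P l = stiff_c P / 2 * (max 0 (l - rest_len P))\<^sup>2"

lemma tension_eq_max:
  assumes "0 < stiff_c P"
  shows "tension P l = stiff_c P * max 0 (l - rest_len P)"
  by (simp add: tension_def max_def)

lemma continuous_on_tension:
  assumes "0 < stiff_c P"
  shows "continuous_on S (tension P)"
  unfolding tension_eq_max[OF assms, abs_def] by (intro continuous_intros)

text \<open>Squaring smooths the kink of \<open>max 0\<close> at the origin. On either side the
  function agrees locally with a square or with 0.\<close>

lemma DERIV_max0_square: "((\<lambda>x. (max 0 x)\<^sup>2) has_real_derivative 2 * max 0 x) (at (x::real))"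
proof -
  have pos: "((\<lambda>x. (max 0 x)\<^sup>2) has_real_derivative 2 * max 0 x) (at x)" if "x > 0" for x :: real
    by (rule DERIV_cong_ev[THEN iffD2, of _ x _ "\<lambda>x. x\<^sup>2"])
       (use that eventually_nhds_in_open[of "{0<..}" x] in
         \<open>auto elim!: eventually_mono intro!: derivative_eq_intros simp: max_def\<close>)
  have neg: "((\<lambda>x. (max 0 x)\<^sup>2) has_real_derivative 2 * max 0 x) (at x)" if "x < 0" for x :: real
    by (rule DERIV_cong_ev[THEN iffD2, of _ x _ "\<lambda>x. 0"])
       (use that eventually_nhds_in_open[of "{..<0}" x] in
         \<open>auto elim!: eventually_mono simp: max_def\<close>)
  \<comment> \<open>At the kink the difference quotient is just \<open>max 0 h\<close>, which tends
    to 0.\<close>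
  have "((\<lambda>h::real. (max 0 h)\<^sup>2 / h) \<longlongrightarrow> 0) (at 0)"
  proof (rule Lim_transform_eventually)
    show "((\<lambda>h::real. max 0 h) \<longlongrightarrow> 0) (at 0)"
      by (auto intro!: tendsto_eq_intros)
  qed (auto intro!: always_eventually simp: max_def power2_eq_square)
  then have "((\<lambda>x. (max 0 x)\<^sup>2) has_real_derivative 2 * max 0 0) (at (0::real))"
    by (simp add: DERIV_def)
  with pos neg show ?thesis
    by (metis linorder_less_linear)
qed

lemma DERIV_elastic_energy:
  assumes "0 < stiff_c P"
  shows "(elastic_energy P has_real_derivative tension P l) (at l)"
  unfolding elastic_energy_def[abs_def] tension_eq_max[OF assms]
  by (rule derivative_eq_intros DERIV_chain2[OF DERIV_max0_square] refl | simp)+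

lemma interval_integral_tension:
  assumes "0 < stiff_c P"
  shows "(LBINT \<tau>=a..b. tension P \<tau>) = elastic_energy P b - elastic_energy P a"
  using DERIV_elastic_energy[OF assms] continuous_on_tension[OF assms]
  by (intro interval_integral_FTC_finite)
     (auto simp: has_real_derivative_iff_has_vector_derivative
           intro: has_vector_derivative_at_within)

text \<open>Away from 0 this is the chain rule. At 0 the norm is not differentiable, but the energy
  vanishes on the ball of radius \<open>rest_len P\<close>, so its gradient is 0 there.\<close>

lemma GDERIV_elastic_energy_norm:
  fixes l :: "'a::euclidean_space"
  assumes "0 < stiff_c P" "0 < rest_len P"
  shows "GDERIV (\<lambda>l. elastic_energy P (norm l)) l :> tension P (norm l) *\<^sub>R (l /\<^sub>R norm l)"
proof (cases "l = 0")
  case True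
  have "((\<lambda>l::'a. elastic_energy P (norm l)) has_derivative (\<lambda>h. 0)) (at 0)"
    by (rule has_derivative_transform_within[of "\<lambda>_. 0" _ _ _ "rest_len P"])
       (use assms in \<open>auto simp: elastic_energy_def max_def\<close>)
  with True assms show ?thesis
    by (simp add: gderiv_def tension_def)
next
  case False
  from GDERIV_DERIV_compose[OF GDERIV_norm[OF False] DERIV_elastic_energy[OF assms(1)]]
  show ?thesis
    by (simp add: sgn_div_norm)
qed

lemma continuous_on_cable_force:
  assumes "0 < stiff_c P" "0 < rest_len P"
  shows "continuous_on UNIV (cable_force P)"
proof -
  \<comment> \<open>Replacing the denominator by a positive maximum removes the singularity at 0.
    The two expressions agree because the tension vanishes up to the rest length.\<close>
  have "cable_force P =
      (\<lambda>x. (tension P (norm (cable x)) / max (rest_len P) (norm (cable x))) *\<^sub>R cable x)"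
    using assms by (auto simp: fun_eq_iff cable_force_def tension_def divide_inverse)
  moreover have "continuous_on UNIV (\<lambda>x. tension P (norm (cable x)))"
    unfolding cable_def pos_R_def pos_H_def tension_eq_max[OF assms(1)]
    by (intro continuous_intros)
  moreover have "max (rest_len P) y \<noteq> 0" for y
    using assms by linarith
  ultimately show ?thesis
    unfolding cable_def pos_R_def pos_H_def
    by (auto intro!: continuous_intros)
qed

text \<open>Complete the square in the stretch \<open>m\<close>: with \<open>s\<close> the stretch
  at which the tension equals \<open>fz\<close>, the right side exceeds the left by
  \<open>k / 2 * (m - s)\<^sup>2 + k * s * (m - (l - r))\<close>, and both summands are
  nonnegative.\<close>

lemma elastic_energy_minus_linear_ge:
  assumes "0 < stiff_c P" "0 < fz"
  shows "elastic_energy P (fz / stiff_c P + rest_len P) - fz * (fz / stiff_c P + rest_len P)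
       \<le> elastic_energy P l - fz * l"
proof -
  define k r s m
    where "k = stiff_c P" and "r = rest_len P" and "s = fz / stiff_c P" and "m = max 0 (l - r)"
  have k: "k > 0" and s: "s > 0" and fz: "fz = k * s"
    using assms by (simp_all add: k_def s_def)
  have "0 \<le> k / 2 * (m - s)\<^sup>2"
    using k by simp
  moreover have "(k * s) * (l - r) \<le> (k * s) * m"
    using k s by (intro mult_left_mono) (simp_all add: m_def)
  ultimately have "k / 2 * s\<^sup>2 - (k * s) * (s + r) \<le> k / 2 * m\<^sup>2 - (k * s) * l"
    by (simp add: algebra_simps power2_eq_square)
  then show ?thesis
    unfolding elastic_energy_def s_def[symmetric] k_def[symmetric] r_def[symmetric]
      m_def[symmetric] fz
    using s k by simp
qed

section \<open>Gradient of the storage function\<close>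

definition storage_grad ::
  "hr_params \<Rightarrow> (real \<Rightarrow> real^3) \<Rightarrow> (real \<Rightarrow> real^3) \<Rightarrow> real \<Rightarrow> state \<Rightarrow> state" where
  "storage_grad P pHr fcr T x =
     (fcr T - cable_force P x,
      mass_H P *\<^sub>R vel_H x,
      cable_force P x - fcr T - KH P *v (robot_ref P pHr fcr T - pos_R x),
      inertia_A P *v vel_R x)"

lemma storage_eq:
  assumes "0 < stiff_c P"
  shows "storage P pHr fcr T lc0 V0 x =
     1/2 * (mass_H P * (vel_H x \<bullet> vel_H x) + vel_R x \<bullet> (inertia_A P *v vel_R x)
        + (robot_ref P pHr fcr T - pos_R x) \<bullet> (KH P *v (robot_ref P pHr fcr T - pos_R x)))
     + (elastic_energy P (norm (cable x)) - elastic_energy P lc0) - cable x \<bullet> fcr T + V0"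
  by (simp add: storage_def interval_integral_tension[OF assms] Let_def)

lemma GDERIV_storage:
  assumes "0 < stiff_c P" "0 < rest_len P" "diagonal (inertia_A P)"
  shows "GDERIV (storage P pHr fcr T lc0 V0) x :> storage_grad P pHr fcr T x"
proof -
  let ?r = "robot_ref P pHr fcr T"
  note sym = inner_matrix_symmetric[OF diagonal_transpose]
  have matrix: "((\<lambda>x. A *v f x) has_derivative (\<lambda>h. A *v f' h)) (at x)"
    if "(f has_derivative f') (at x)" for A :: "real^3^3" and f :: "state \<Rightarrow> real^3" and f'
    using that by (rule bounded_linear.has_derivative[OF matrix_vector_mul_bounded_linear])
  have "((\<lambda>x. elastic_energy P (norm (cable x))) has_derivative
      (\<lambda>h. cable h \<bullet> cable_force P x)) (at x)"
  proof -
    \<comment> \<open>\<open>cable\<close> is linear in the state, hence its own derivative.\<close>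
    have "(cable has_derivative cable) (at x)"
      unfolding cable_def[abs_def] pos_R_def pos_H_def by (auto intro!: derivative_eq_intros)
    from has_derivative_compose[OF this
        GDERIV_elastic_energy_norm[OF assms(1,2), of "cable x", unfolded gderiv_def]]
    show ?thesis
      by (simp add: cable_force_def)
  qed
  note elastic = this[unfolded cable_def pos_R_def pos_H_def]
  show ?thesis
    unfolding gderiv_def storage_eq[OF assms(1), abs_def] cable_def pos_R_def pos_H_def
      vel_R_def vel_H_def
    apply (rule derivative_eq_intros elastic matrix refl)+
    \<comment> \<open>Differentiating a quadratic form gives two cross terms. Symmetry of
      \<open>inertia_A P\<close> and \<open>KH P\<close> merges them, which cancels the factor
      1/2.\<close>
    using sym[OF assms(3), of "snd (snd (snd x))"] sym[OF diagonal_KH, of ?r]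
      sym[OF diagonal_KH, of "fst (snd (snd x))"]
    by (auto simp: fun_eq_iff storage_grad_def inner_prod_def vel_R_def vel_H_def pos_R_def
        inner_diff_left inner_diff_right inner_commute algebra_simps matrix_vector_mult_diff_distrib
        linear_neg[OF matrix_vector_mul_linear])
qed

lemma continuous_on_storage_grad:
  assumes "0 < stiff_c P" "0 < rest_len P"
  shows "continuous_on UNIV (storage_grad P pHr fcr T)"
  unfolding storage_grad_def[abs_def] vel_R_def vel_H_def pos_R_def
  by (intro continuous_intros continuous_on_cable_force assms
      matrix_vector_mul_bounded_linear[THEN bounded_linear.continuous_on])

section \<open>Minimality of the storage function at the final state\<close>

lemma storage_final_state:
  assumes "0 < stiff_c P" "0 < rest_len P" "fcr T = fz *\<^sub>R zW" "0 < fz"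
  shows "storage P pHr fcr T lc0 V0 (final_state P pHr fcr T) =
     elastic_energy P (fz / stiff_c P + rest_len P) - elastic_energy P lc0
     - fz * (fz / stiff_c P + rest_len P) + V0"
proof -
  have z: "zW \<bullet> zW = 1" "norm zW = 1"
    by (simp_all add: zW_def inner_axis_axis)
  \<comment> \<open>The reference offset is the desired force times
    \<open>1 / stiff_c P + rest_len P / fz\<close>, so the cable is vertical and its tension is
    exactly \<open>fz\<close>.\<close>
  have c: "cable (final_state P pHr fcr T) = (fz / stiff_c P + rest_len P) *\<^sub>R zW"
    using assms z
    by (simp add: cable_def final_state_def pos_R_def pos_H_def robot_ref_def field_simps)
  have "norm (cable (final_state P pHr fcr T)) = fz / stiff_c P + rest_len P"
    unfolding c using assms z by (simp add: add_pos_pos)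
  moreover have "cable (final_state P pHr fcr T) \<bullet> fcr T = fz * (fz / stiff_c P + rest_len P)"
    unfolding c using assms z by simp
  ultimately show ?thesis
    unfolding storage_eq[OF assms(1)]
    by (simp add: final_state_def vel_H_def vel_R_def pos_R_def)
qed

lemma storage_final_state_le:
  assumes "0 < mass_H P" "0 < stiff_c P" "0 < rest_len P" "0 < gain_H P"
    and "positive_definite (inertia_A P)" "fcr T = fz *\<^sub>R zW" "0 < fz"
  shows "storage P pHr fcr T lc0 V0 (final_state P pHr fcr T) \<le> storage P pHr fcr T lc0 V0 x"
proof -
  \<comment> \<open>Cauchy-Schwarz leaves a function of the cable length alone. The kinetic and
    proportional terms vanish at the final state and are nonnegative elsewhere.\<close>
  have "cable x \<bullet> fcr T \<le> norm (cable x) * norm (fcr T)"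
    by (rule norm_cauchy_schwarz)
  also have "norm (fcr T) = fz"
    using assms by (simp add: zW_def)
  finally have "cable x \<bullet> fcr T \<le> fz * norm (cable x)"
    by (simp add: mult.commute)
  moreover have "0 \<le> mass_H P * (vel_H x \<bullet> vel_H x)"
    using assms by simp
  ultimately show ?thesis
    unfolding storage_final_state[where fcr = fcr and T = T, OF assms(2,3,6,7)] storage_eq[where x = x, OF assms(2)]
    using elastic_energy_minus_linear_ge[OF assms(2,7), of "norm (cable x)"]
      positive_definite_nonneg[OF assms(5), of "vel_R x"]
      KH_nonneg[OF assms(4), of "robot_ref P pHr fcr T - pos_R x"]
    by argo
qed

section \<open>Power balance along the dynamics\<close>

lemma storage_grad_dynamics:
  assumes "0 < mass_H P" "positive_definite (inertia_A P)" "diagonal (inertia_A P)"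
    and "fcr T = fz *\<^sub>R zW" "x \<in> state_space"
  shows "storage_grad P pHr fcr T x \<bullet> dynamics P x (control_law P pHr fcr T x u) =
     u \<bullet> vel_R x - vel_R x \<bullet> (damp_A P *v vel_R x) - vel_H x \<bullet> (damp_H P *v vel_H x)"
proof -
  let ?e = "robot_ref P pHr fcr T - pos_R x"
  let ?F = "- (damp_A P *v vel_R x) - cable_force P x + control_law P pHr fcr T x u"
  have z: "zW \<bullet> vel_H x = 0" "vel_H x \<bullet> zW = 0"
    using assms(5) by (simp_all add: state_space_def inner_commute)
  \<comment> \<open>Symmetry moves the inertia matrix to the other factor, where it meets its
    inverse.\<close>
  have "(inertia_A P *v vel_R x) \<bullet> (matrix_inv (inertia_A P) *v ?F)
      = vel_R x \<bullet> ((inertia_A P ** matrix_inv (inertia_A P)) *v ?F)"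
    using inner_matrix_symmetric[OF diagonal_transpose[OF assms(3)]]
    by (metis inner_commute matrix_vector_mul_assoc)
  also have "\<dots> = vel_R x \<bullet> ?F"
    by (simp add: matrix_inv_right positive_definite_invertible[OF assms(2)])
  finally have R: "(inertia_A P *v vel_R x) \<bullet> accel_R P x (control_law P pHr fcr T x u)
      = vel_R x \<bullet> ?F"
    by (simp add: accel_R_def)
  \<comment> \<open>Gravity and the ground reaction are multiples of \<open>zW\<close>, hence
    orthogonal to \<open>vel_H x\<close>.\<close>
  have H: "(mass_H P *\<^sub>R vel_H x) \<bullet> accel_H P x (ground_force P x)
      = vel_H x \<bullet> cable_force P x - vel_H x \<bullet> (damp_H P *v vel_H x)"
    using assms(1) z by (simp add: accel_H_def ground_force_def inner_simps diff_divide_distrib)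
  show ?thesis
    unfolding storage_grad_def dynamics_def inner_Pair R H
    using z by (simp add: control_law_def assms(4) inner_simps inner_commute)
qed

theorem theorem2:
  fixes P :: hr_params
    and T fz V0 :: real
    and pHr fcr :: "real \<Rightarrow> real^3"
    and x0 :: state
  assumes "mass_H P > 0" and "grav P > 0" and "stiff_c P > 0"
    and "rest_len P > 0" and "gain_H P > 0"
    and "positive_definite (damp_H P)"
    and "positive_definite (inertia_A P)" and "diagonal (inertia_A P)"
    and "positive_definite (damp_A P)" and "diagonal (damp_A P)"
    and "T > 0"
    and "\<forall>t\<in>{0..T}. fcr t \<noteq> 0"
    and "zW \<bullet> pHr T = 0"
    and "fcr T = fz *\<^sub>R zW" and "0 < fz" and "fz < mass_H P * grav P"
    and "x0 \<in> state_space"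
    and "storage P pHr fcr T (norm (cable x0)) V0 (final_state P pHr fcr T) = 0"
  shows "output_strictly_passive state_space
           (\<lambda>x u1. dynamics P x (control_law P pHr fcr T x u1)) vel_R
           (storage P pHr fcr T (norm (cable x0)) V0)
       \<and> (\<forall>t\<in>{0..T}. \<forall>x. control_law P pHr fcr T x (ref_input P pHr fcr T t)
             = KH P *v (robot_ref P pHr fcr t - pos_R x) + fcr t)"
proof (intro conjI ballI allI)
  show "output_strictly_passive state_space
      (\<lambda>x u1. dynamics P x (control_law P pHr fcr T x u1)) vel_R
      (storage P pHr fcr T (norm (cable x0)) V0)"
    unfolding output_strictly_passive_def
  \<comment> \<open>The robot damping serves as the dissipation \<open>\<phi>\<close>. The human
    damping is nonnegative and is dropped, which turns the power balance into an inequality.\<close>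
  proof (intro exI[of _ "storage_grad P pHr fcr T"] exI[of _ "\<lambda>y. damp_A P *v y"] conjI ballI allI impI)
    fix x u assume x: "x \<in> state_space"
    show "0 \<le> storage P pHr fcr T (norm (cable x0)) V0 x"
      \<comment> \<open>The choice of \<open>V0\<close> makes the minimal value of the storage
        function 0.\<close>
      using storage_final_state_le[where fcr = fcr and T = T, OF assms(1,3,4,5,7,14,15)] assms(18) by metis
    show "storage_grad P pHr fcr T x \<bullet> dynamics P x (control_law P pHr fcr T x u)
        \<le> u \<bullet> vel_R x - vel_R x \<bullet> (damp_A P *v vel_R x)"
      using storage_grad_dynamics[of P fcr T fz x pHr u] x assms(1,7,8,14)
        positive_definite_nonneg[OF assms(6), of "vel_H x"] by simp
  qed (use assms in \<open>auto simp: positive_definite_def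
      intro: GDERIV_storage continuous_on_storage_grad\<close>)
next
  fix t x
  show "control_law P pHr fcr T x (ref_input P pHr fcr T t)
      = KH P *v (robot_ref P pHr fcr t - pos_R x) + fcr t"
    by (simp add: control_law_def ref_input_def matrix_vector_mult_diff_distrib)
qed

end
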